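(* Let $G=(V,E)$ be a graph on $n$ vertices and let $c\in\mathbb{N}$. For any $N\in\mathbb{N}$, the problem of minimising $L_{G,c}$ over the set $C^N(n,c)$ is a semidefinite program (SDP).
   Context: Graphs are finite, simple and undirected ($E\subseteq V\times V$ is symmetric; $v\sim w$ means $(v,w)\in E$). The graph functional $L_{G,c}:M_{nc}\to\mathbb{C}$ is $L_{G,c}((a_{v,i,w,j}))=\sum_{v}\sum_{i\ne j}a_{v,i,v,j}+\sum_{v\sim w}\sum_i a_{v,i,w,i}$, where $v,w\in V$, $1\le i,j\le c$. Let $F(n,c)=\mathbb{Z}_c*\cdots*\mathbb{Z}_c$ ($n$ copies). The full group C*-algebra $C^*(F(n,c)\times F(n,c))$ is the universal unital C*-algebra generated by two families $\mathcal E=\{e_{v,i}:v\in V,1\le i\le c\}$ and $\mathcal F=\{f_{w,j}:w\in V,1\le j\le c\}$ of projections with $\sum_i e_{v,i}=1$, $\sum_j f_{w,j}=1$ for all $v,w$ and $e_{v,i}f_{w,j}=f_{w,j}e_{v,i}$ for all $v,w,i,j$. A word is a (possibly empty) product of elements of $\mathcal E\cup\mathcal F$, regarded as an element of this C*-algebra; its length is the smallest number of factors with which it can be so written (the unit $1$ has length $0$). Let $\Gamma_N$ be the set of words of length at most $N$, $\mathcal A_N=\mathrm{span}\,\Gamma_N$, $\mathcal A=\bigcup_N\mathcal A_N$. Let $S_N$ be the set of linear functionals $s:\mathcal A\to\mathbb{C}$ with $s(1)=1$ and $s(p^*p)\ge 0$ for all $p\in\mathcal A_N$, and $C^N(n,c)=\{(s(e_{v,i}f_{w,j}))_{v,i,w,j}:s\in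 S_N\}\subseteq M_{nc}$. A spectrahedron is a set that can be realised as the intersection of the set of positive semidefinite matrices of some size with an affine subset. An SDP is the problem of minimising a linear functional over a spectrahedron; minimising a linear functional $L$ over a set $K$ is regarded as an SDP when $K$ is the image $\pi(\mathcal B)$ of a spectrahedron $\mathcal B$ under a linear map $\pi$, so that the problem is the same as minimising $L\circ\pi$ over $\mathcal B$. *)

theory Defs
  imports
    "HOL-Analysis.Abstract_Metric_Spaces"
    "Jordan_Normal_Form.VS_Connect"
    "Jordan_Normal_Form.Schur_Decomposition"
begin

record 'a star_normed_algebra = "(complex, 'a) module" +
  star :: "'a \<Rightarrow> 'a"
  cnorm :: "'a \<Rightarrow> real"

definition unital_cstar_algebra :: "'a star_normed_algebra \<Rightarrow> bool" where
  "unital_cstar_algebra A \<longleftrightarrow>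
     Ring.ring A \<and> Module.module class_ring A \<and>
     (\<forall>a. \<forall>x\<in>carrier A. \<forall>y\<in>carrier A.
        (a \<odot>\<^bsub>A\<^esub> x) \<otimes>\<^bsub>A\<^esub> y = a \<odot>\<^bsub>A\<^esub> (x \<otimes>\<^bsub>A\<^esub> y) \<and> x \<otimes>\<^bsub>A\<^esub> (a \<odot>\<^bsub>A\<^esub> y) = a \<odot>\<^bsub>A\<^esub> (x \<otimes>\<^bsub>A\<^esub> y)) \<and>
     (\<forall>x\<in>carrier A. star A x \<in> carrier A \<and> star A (star A x) = x) \<and>
     (\<forall>x\<in>carrier A. \<forall>y\<in>carrier A.
        star A (x \<oplus>\<^bsub>A\<^esub> y) = star A x \<oplus>\<^bsub>A\<^esub> star A y \<and> star A (x \<otimes>\<^bsub>A\<^esub> y) = star A y \<otimes>\<^bsub>A\<^esub> star A x) \<and>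
     (\<forall>a. \<forall>x\<in>carrier A. star A (a \<odot>\<^bsub>A\<^esub> x) = cnj a \<odot>\<^bsub>A\<^esub> star A x) \<and>
     (\<forall>x\<in>carrier A. 0 \<le> cnorm A x \<and> (cnorm A x = 0 \<longleftrightarrow> x = \<zero>\<^bsub>A\<^esub>)) \<and>
     (\<forall>a. \<forall>x\<in>carrier A. cnorm A (a \<odot>\<^bsub>A\<^esub> x) = cmod a * cnorm A x) \<and>
     (\<forall>x\<in>carrier A. \<forall>y\<in>carrier A.
        cnorm A (x \<oplus>\<^bsub>A\<^esub> y) \<le> cnorm A x + cnorm A y \<and> cnorm A (x \<otimes>\<^bsub>A\<^esub> y) \<le> cnorm A x * cnorm A y) \<and>
     (\<forall>x\<in>carrier A. cnorm A (star A x \<otimes>\<^bsub>A\<^esub> x) = (cnorm A x)\<^sup>2) \<and>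
     Metric_space.mcomplete (carrier A) (\<lambda>x y. cnorm A (x \<ominus>\<^bsub>A\<^esub> y))"

definition unital_star_hom ::
    "'a star_normed_algebra \<Rightarrow> 'b star_normed_algebra \<Rightarrow> ('a \<Rightarrow> 'b) \<Rightarrow> bool" where
  "unital_star_hom A B h \<longleftrightarrow> h \<in> Ring.ring_hom A B \<and>
     (\<forall>a. \<forall>x\<in>carrier A. h (a \<odot>\<^bsub>A\<^esub> x) = a \<odot>\<^bsub>B\<^esub> h x) \<and>
     (\<forall>x\<in>carrier A. h (star A x) = star B (h x))"

definition is_projection :: "'a star_normed_algebra \<Rightarrow> 'a \<Rightarrow> bool" where
  "is_projection A p \<longleftrightarrow> p \<in> carrier A \<and> star A p = p \<and> p \<otimes>\<^bsub>A\<^esub> p = p"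

definition commuting_projection_families ::
    "'a star_normed_algebra \<Rightarrow> ('v::finite \<Rightarrow> 'c::finite \<Rightarrow> 'a) \<Rightarrow> ('v \<Rightarrow> 'c \<Rightarrow> 'a) \<Rightarrow> bool" where
  "commuting_projection_families A e f \<longleftrightarrow>
     (\<forall>v i. is_projection A (e v i) \<and> is_projection A (f v i)) \<and>
     (\<forall>v. (\<Oplus>\<^bsub>A\<^esub> i\<in>UNIV. e v i) = \<one>\<^bsub>A\<^esub>) \<and>
     (\<forall>w. (\<Oplus>\<^bsub>A\<^esub> j\<in>UNIV. f w j) = \<one>\<^bsub>A\<^esub>) \<and>
     (\<forall>v i w j. e v i \<otimes>\<^bsub>A\<^esub> f w j = f w j \<otimes>\<^bsub>A\<^esub> e v i)"

definition generators :: "('v \<Rightarrow> 'c \<Rightarrow> 'a) \<Rightarrow> ('v \<Rightarrow> 'c \<Rightarrow> 'a) \<Rightarrow> 'a set" where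
  "generators e f = {e v i | v i. True} \<union> {f w j | w j. True}"

text \<open>
  The universal property characterises \<open>C\<^sup>*(F(n,c) \<times> F(n,c))\<close>, with \<open>n = CARD('v)\<close> and \<open>c = CARD('c)\<close>,
  together with its generators up to unique isomorphism. HOL cannot quantify over all types inside
  a formula, so the targets \<open>B\<close> are the C*-algebras whose carrier is a set of reals. This loses
  nothing: the C*-subalgebra of any target generated by the finitely many \<open>e'\<close>, \<open>f'\<close> is separable,
  so it has at most continuum many elements and is isomorphic to one of these. Uniqueness of
  the homomorphism follows from generation.
\<close>
definition universal_cstar_algebra ::
    "'a star_normed_algebra \<Rightarrow> ('v::finite \<Rightarrow> 'c::finite \<Rightarrow> 'a) \<Rightarrow> ('v \<Rightarrow> 'c \<Rightarrow> 'a) \<Rightarrow> bool" where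
  "universal_cstar_algebra A e f \<longleftrightarrow>
     unital_cstar_algebra A \<and> commuting_projection_families A e f \<and>
     (\<forall>D. D \<subseteq> carrier A \<and> generators e f \<subseteq> D \<and> unital_cstar_algebra (A\<lparr>carrier := D\<rparr>)
        \<longrightarrow> D = carrier A) \<and>
     (\<forall>(B :: real star_normed_algebra) e' f'.
        unital_cstar_algebra B \<and> commuting_projection_families B e' f' \<longrightarrow>
        (\<exists>h. unital_star_hom A B h \<and> (\<forall>v i. h (e v i) = e' v i \<and> h (f v i) = f' v i)))"

definition word_prod :: "'a star_normed_algebra \<Rightarrow> 'a list \<Rightarrow> 'a" where
  "word_prod A xs = foldr (\<lambda>x y. x \<otimes>\<^bsub>A\<^esub> y) xs \<one>\<^bsub>A\<^esub>"

definition is_word :: "'a star_normed_algebra \<Rightarrow> 'a set \<Rightarrow> 'a \<Rightarrow> bool" where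
  "is_word A X g \<longleftrightarrow> (\<exists>xs\<in>lists X. g = word_prod A xs)"

definition word_length :: "'a star_normed_algebra \<Rightarrow> 'a set \<Rightarrow> 'a \<Rightarrow> nat" where
  "word_length A X g = (LEAST m. \<exists>xs\<in>lists X. length xs = m \<and> g = word_prod A xs)"

definition words_upto :: "'a star_normed_algebra \<Rightarrow> 'a set \<Rightarrow> nat \<Rightarrow> 'a set" where
  "words_upto A X N = {g. is_word A X g \<and> word_length A X g \<le> N}"

definition alg_upto :: "'a star_normed_algebra \<Rightarrow> 'a set \<Rightarrow> nat \<Rightarrow> 'a set" where
  "alg_upto A X N = LinearCombinations.module.span class_ring A (words_upto A X N)"

definition alg :: "'a star_normed_algebra \<Rightarrow> 'a set \<Rightarrow> 'a set" where
  "alg A X = (\<Union>N. alg_upto A X N)"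

text \<open>
  Only the values of \<open>s\<close> on \<^term>\<open>alg A X\<close> matter. In the order on \<^typ>\<open>complex\<close> used here,
  \<open>0 \<le> z\<close> means that \<open>z\<close> is real and nonnegative.
\<close>
definition functionals :: "'a star_normed_algebra \<Rightarrow> 'a set \<Rightarrow> nat \<Rightarrow> ('a \<Rightarrow> complex) set" where
  "functionals A X N = {s.
     (\<forall>x\<in>alg A X. \<forall>y\<in>alg A X. s (x \<oplus>\<^bsub>A\<^esub> y) = s x + s y) \<and>
     (\<forall>a. \<forall>x\<in>alg A X. s (a \<odot>\<^bsub>A\<^esub> x) = a * s x) \<and>
     s \<one>\<^bsub>A\<^esub> = 1 \<and>
     (\<forall>p\<in>alg_upto A X N. 0 \<le> s (star A p \<otimes>\<^bsub>A\<^esub> p))}"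

text \<open>An element of \<open>M\<^sub>n\<^sub>c\<close> is given by its entries \<open>a (v, i, w, j)\<close>, with row \<open>(v, i)\<close> and column \<open>(w, j)\<close>.\<close>
type_synonym ('v, 'c) block_matrix = "'v \<times> 'c \<times> 'v \<times> 'c \<Rightarrow> complex"

definition correlations ::
    "'a star_normed_algebra \<Rightarrow> ('v \<Rightarrow> 'c \<Rightarrow> 'a) \<Rightarrow> ('v \<Rightarrow> 'c \<Rightarrow> 'a) \<Rightarrow> nat
      \<Rightarrow> ('v, 'c) block_matrix set" where
  "correlations A e f N =
     {(\<lambda>(v, i, w, j). s (e v i \<otimes>\<^bsub>A\<^esub> f w j)) | s. s \<in> functionals A (generators e f) N}"

definition graph_functional ::
    "('v::finite \<times> 'v) set \<Rightarrow> ('v, 'c::finite) block_matrix \<Rightarrow> complex" where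
  "graph_functional E a =
     (\<Sum>v\<in>UNIV. \<Sum>(i, j)\<in>{(i, j). i \<noteq> j}. a (v, i, v, j)) +
     (\<Sum>(v, w)\<in>E. \<Sum>i\<in>UNIV. a (v, i, w, i))"

definition psd_mats :: "nat \<Rightarrow> complex mat set" where
  "psd_mats k = {M \<in> carrier_mat k k. mat_adjoint M = M \<and>
     (\<forall>x\<in>carrier_vec k. 0 \<le> (M *\<^sub>v x) \<bullet>c x)}"

definition affine_mats :: "nat \<Rightarrow> complex mat set \<Rightarrow> bool" where
  "affine_mats k S \<longleftrightarrow> S \<subseteq> carrier_mat k k \<and>
     (\<forall>P\<in>S. \<forall>Q\<in>S. \<forall>t::real. complex_of_real (1 - t) \<cdot>\<^sub>m P + complex_of_real t \<cdot>\<^sub>m Q \<in> S)"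

definition spectrahedron :: "nat \<Rightarrow> complex mat set \<Rightarrow> bool" where
  "spectrahedron k B \<longleftrightarrow> (\<exists>S. affine_mats k S \<and> B = psd_mats k \<inter> S)"

definition linear_on_mats :: "nat \<Rightarrow> (complex mat \<Rightarrow> 'm \<Rightarrow> complex) \<Rightarrow> bool" where
  "linear_on_mats k \<pi> \<longleftrightarrow>
     (\<forall>P\<in>carrier_mat k k. \<forall>Q\<in>carrier_mat k k. \<forall>x. \<pi> (P + Q) x = \<pi> P x + \<pi> Q x) \<and>
     (\<forall>a. \<forall>P\<in>carrier_mat k k. \<forall>x. \<pi> (a \<cdot>\<^sub>m P) x = a * \<pi> P x)"

definition linear_functional :: "(('m \<Rightarrow> complex) \<Rightarrow> complex) \<Rightarrow> bool" where
  "linear_functional L \<longleftrightarrow>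
     (\<forall>a b. L (\<lambda>x. a x + b x) = L a + L b) \<and> (\<forall>t a. L (\<lambda>x. t * a x) = t * L a)"

text \<open>
  Minimising \<open>L\<close> over \<open>K\<close>. Since \<open>K = \<pi> ` B\<close>, it is the problem of minimising the linear functional
  \<open>L \<circ> \<pi>\<close> over the spectrahedron \<open>B\<close>.
\<close>
definition minimisation_is_SDP ::
    "(('m \<Rightarrow> complex) \<Rightarrow> complex) \<Rightarrow> ('m \<Rightarrow> complex) set \<Rightarrow> bool" where
  "minimisation_is_SDP L K \<longleftrightarrow> linear_functional L \<and>
     (\<exists>k B \<pi>. spectrahedron k B \<and> linear_on_mats k \<pi> \<and> K = \<pi> ` B)"

end

theory Submission
  imports Defs
begin

text \<open>
  Enumerate the words of length at most \<open>N\<close> as \<open>h 0, \<dots>, h (k - 1)\<close> and attach to a functional \<open>s\<close>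
  its Gram (moment) matrix with entries \<open>s (star (h i) h j)\<close>. An element \<open>p\<close> of the span of these
  words is a combination \<open>\<Sum>i. x i h i\<close>, and \<open>s (star p p)\<close> is the value at \<open>x\<close> of the quadratic form
  of the Gram matrix. Hence \<open>s\<close> is positive on squares from that span if and only if its Gram
  matrix is positive semidefinite (\<open>functionals_iff_gram_psd\<close>). The Gram matrix depends affinely
  on \<open>s\<close>, so the Gram matrices of all normalised linear functionals form an affine set
  (\<open>affine_gram_image\<close>), and those of the functionals in \<open>S\<^sub>N\<close> form a spectrahedron. Taking the
  affine set to be the image of the functionals, instead of cutting it out by equations between
  entries, means that no functional ever has to be extended from a subspace to the whole algebra.

  If \<open>N \<ge> 1\<close>, then every generator is among the \<open>h i\<close>, and because generators are self-adjoint the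
  numbers \<open>s (e v i f w j)\<close> are entries of the Gram matrix. Reading off these entries is the
  linear map that carries the spectrahedron onto the correlation set.

  If \<open>N = 0\<close>, the Gram matrix is the number \<open>s 1 = 1\<close>; it does not contain the correlations, but
  positivity then holds for every normalised functional (\<open>functionals_0\<close>), so the correlation set
  is affine. Every affine set in a space of finite tuples is a linear image of a spectrahedron
  (\<open>affine_set_is_projected_spectrahedron\<close>), since any tuple occurs as part of a column of a rank
  one positive semidefinite matrix.
\<close>

section \<open>Positive semidefinite matrices\<close>

definition quad_form :: "nat \<Rightarrow> complex mat \<Rightarrow> (nat \<Rightarrow> complex) \<Rightarrow> complex" where
  "quad_form k M x = (\<Sum>i<k. \<Sum>j<k. cnj (x i) * x j * M $$ (i, j))"

lemma quad_form_eq_cscalar_prod: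
  assumes "M \<in> carrier_mat k k"
  shows "(M *\<^sub>v vec k x) \<bullet>c vec k x = quad_form k M x"
proof -
  have "(M *\<^sub>v vec k x) \<bullet>c vec k x = (\<Sum>i<k. (\<Sum>j<k. M $$ (i, j) * x j) * cnj (x i))"
    using assms by (simp add: scalar_prod_def lessThan_atLeast0)
  also have "\<dots> = quad_form k M x"
    unfolding quad_form_def sum_distrib_right by (intro sum.cong refl) (simp only: mult_ac)
  finally show ?thesis .
qed

text \<open>
  Vectors supported on two coordinates are enough to recover all entries of a matrix from its
  quadratic form; the case \<open>i = j\<close> is included.
\<close>

lemma quad_form_two_entries:
  assumes "i < k" "j < k"
  shows "quad_form k M (\<lambda>l. (if l = i then a else 0) + (if l = j then b else 0)) =
    cnj a * (a * M $$ (i, i) + b * M $$ (i, j)) + cnj b * (a * M $$ (j, i) + b * M $$ (j, j))"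
proof -
  have select: "(\<Sum>l<k. ((if l = i then a else 0) + (if l = j then b else 0)) * g l) = a * g i + b * g j"
    for a b and g :: "nat \<Rightarrow> complex"
  proof -
    have "(if P then c else 0) * d = (if P then c * d else 0)" for P and c d :: complex by simp
    with assms show ?thesis by (simp add: distrib_right sum.distrib)
  qed
  have "quad_form k M (\<lambda>l. (if l = i then a else 0) + (if l = j then b else 0)) =
      (\<Sum>l<k. ((if l = i then cnj a else 0) + (if l = j then cnj b else 0)) *
        (\<Sum>m<k. ((if m = i then a else 0) + (if m = j then b else 0)) * M $$ (l, m)))"
    unfolding quad_form_def sum_distrib_left by (intro sum.cong) auto
  then show ?thesis unfolding select .
qed

text \<open>
  Polarisation. Over the complex numbers a form with real values is Hermitian, because coefficients
  \<open>1\<close> and \<open>\<i>\<close> in the \<open>j\<close>-th coordinate isolate the imaginary part of \<open>M i j + M j i\<close> and the real part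
  of \<open>M i j - M j i\<close>.
\<close>

lemma hermitian_if_quad_form_real:
  assumes real: "\<And>x. Im (quad_form k M x) = 0" and "i < k" "j < k"
  shows "cnj (M $$ (j, i)) = M $$ (i, j)"
proof -
  have *: "Im (cnj a * (a * M $$ (i, i) + b * M $$ (i, j)) +
      cnj b * (a * M $$ (j, i) + b * M $$ (j, j))) = 0" for a b
    using real by (simp only: quad_form_two_entries[OF assms(2,3), symmetric])
  show ?thesis
    using *[of 1 0] *[of 0 1] *[of 1 1] *[of 1 \<i>] by (simp add: complex_eq_iff)
qed

text \<open>
  Self-adjointness comes for free from positivity of the form, and test vectors may be taken as
  plain functions. In this shape the condition can be compared directly with positivity of a
  functional.
\<close>

lemma psd_mats_iff:
  "M \<in> psd_mats k \<longleftrightarrow> M \<in> carrier_mat k k \<and> (\<forall>x. 0 \<le> quad_form k M x)"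
proof (intro iffI conjI allI)
  assume M: "M \<in> psd_mats k"
  then show "M \<in> carrier_mat k k" by (simp add: psd_mats_def)
  then show "0 \<le> quad_form k M x" for x
    using M by (simp add: psd_mats_def flip: quad_form_eq_cscalar_prod)
next
  assume M: "M \<in> carrier_mat k k \<and> (\<forall>x. 0 \<le> quad_form k M x)"
  then have "Im (quad_form k M x) = 0" for x
    by (simp add: less_eq_complex_def)
  then have "mat_adjoint M = M"
    using M hermitian_if_quad_form_real[of k M]
    by (intro eq_matI) (auto simp: mat_adjoint_def mat_of_rows_def)
  moreover have "0 \<le> (M *\<^sub>v x) \<bullet>c x" if "x \<in> carrier_vec k" for x
  proof -
    have "vec k (\<lambda>i. x $ i) = x" using that by auto
    then show ?thesis using M quad_form_eq_cscalar_prod[of M k "\<lambda>i. x $ i"] by simp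
  qed
  ultimately show "M \<in> psd_mats k" using M by (simp add: psd_mats_def)
qed

lemma rank_one_psd: "mat k k (\<lambda>(i, j). v i * cnj (v j)) \<in> psd_mats k"
proof -
  have "quad_form k (mat k k (\<lambda>(i, j). v i * cnj (v j))) x =
      (\<Sum>i<k. cnj (x i) * v i) * cnj (\<Sum>i<k. cnj (x i) * v i)" for x
    by (simp add: quad_form_def sum_product mult_ac)
  moreover have "0 \<le> z * cnj z" for z :: complex
    by (simp add: less_eq_complex_def complex_mult_cnj)
  ultimately have "0 \<le> quad_form k (mat k k (\<lambda>(i, j). v i * cnj (v j))) x" for x
    by (simp only:)
  then show ?thesis by (simp add: psd_mats_iff)
qed

section \<open>Affine sets as images of spectrahedra\<close>

text \<open>
  The last column, without its bottom entry, of a positive semidefinite matrix can be any vector: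
  for \<open>v = (a, 1)\<close> the matrix \<open>v v\<^sup>*\<close> has \<open>a\<close> there. So the matrices whose last column lies in \<open>K\<close>
  form an affine set, and its positive semidefinite part still projects onto all of \<open>K\<close>.
\<close>

lemma affine_set_is_projected_spectrahedron:
  fixes K :: "('m::finite \<Rightarrow> complex) set"
  assumes affine: "\<And>a b t::real. a \<in> K \<Longrightarrow> b \<in> K \<Longrightarrow>
    (\<lambda>x. complex_of_real (1 - t) * a x + complex_of_real t * b x) \<in> K"
  shows "\<exists>k B \<pi>. spectrahedron k B \<and> linear_on_mats k \<pi> \<and> K = \<pi> ` B"
proof -
  define d where "d = card (UNIV :: 'm set)"
  obtain h :: "'m \<Rightarrow> nat" where h: "bij_betw h UNIV {0..<d}"
    using ex_bij_betw_finite_nat[of "UNIV :: 'm set"] by (auto simp: d_def)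
  have hd: "h x < d" for x using h by (auto simp: bij_betw_def)
  then have hd': "h x < Suc d" for x using less_Suc_eq by blast
  have hinv: "inv_into UNIV h (h x) = x" for x
    using h by (auto simp: bij_betw_def)
  define \<pi> :: "complex mat \<Rightarrow> 'm \<Rightarrow> complex" where "\<pi> M x = M $$ (h x, d)" for M x
  define S where "S = {M \<in> carrier_mat (Suc d) (Suc d). \<pi> M \<in> K}"
  have lin: "linear_on_mats (Suc d) \<pi>"
    unfolding linear_on_mats_def \<pi>_def using hd' by auto
  have "affine_mats (Suc d) S"
    unfolding affine_mats_def
  proof (intro conjI ballI allI)
    fix P Q and t :: real assume PQ: "P \<in> S" "Q \<in> S"
    have "\<pi> (complex_of_real (1 - t) \<cdot>\<^sub>m P + complex_of_real t \<cdot>\<^sub>m Q) =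
        (\<lambda>x. complex_of_real (1 - t) * \<pi> P x + complex_of_real t * \<pi> Q x)"
      using PQ hd' by (auto simp: S_def \<pi>_def fun_eq_iff)
    then show "complex_of_real (1 - t) \<cdot>\<^sub>m P + complex_of_real t \<cdot>\<^sub>m Q \<in> S"
      using PQ affine[of "\<pi> P" "\<pi> Q" t] by (auto simp: S_def)
  qed (auto simp: S_def)
  then have "spectrahedron (Suc d) (psd_mats (Suc d) \<inter> S)"
    unfolding spectrahedron_def by blast
  moreover have "K = \<pi> ` (psd_mats (Suc d) \<inter> S)"
  proof (intro equalityI subsetI)
    fix a assume a: "a \<in> K"
    define v where "v i = (if i < d then a (inv_into UNIV h i) else 1)" for i
    define M where "M = mat (Suc d) (Suc d) (\<lambda>(i, j). v i * cnj (v j))"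
    have "\<pi> M = a"
      using hd hd' hinv by (auto simp: \<pi>_def M_def v_def fun_eq_iff)
    moreover have "M \<in> psd_mats (Suc d)" unfolding M_def by (rule rank_one_psd)
    ultimately show "a \<in> \<pi> ` (psd_mats (Suc d) \<inter> S)"
      using a by (auto simp: S_def psd_mats_def)
  qed (auto simp: S_def)
  ultimately show ?thesis using lin by blast
qed

section \<open>Words and the algebra that they span\<close>

locale unital_cstar =
  fixes A :: "'a star_normed_algebra" (structure)
  assumes cstar: "unital_cstar_algebra A"

sublocale unital_cstar \<subseteq> Alg: Ring.ring A
  using cstar by (simp add: unital_cstar_algebra_def)

sublocale unital_cstar \<subseteq> Module.module class_ring A
  using cstar by (simp add: unital_cstar_algebra_def)

context unital_cstar
begin

lemma scale_mult:
  assumes "x \<in> carrier A" "y \<in> carrier A"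
  shows "(a \<odot> x) \<otimes> y = a \<odot> (x \<otimes> y)" and "x \<otimes> (a \<odot> y) = a \<odot> (x \<otimes> y)"
  using cstar assms by (simp_all add: unital_cstar_algebra_def)

lemma star_closed [simp]: "x \<in> carrier A \<Longrightarrow> star A x \<in> carrier A"
  and star_star [simp]: "x \<in> carrier A \<Longrightarrow> star A (star A x) = x"
  and star_add: "x \<in> carrier A \<Longrightarrow> y \<in> carrier A \<Longrightarrow> star A (x \<oplus> y) = star A x \<oplus> star A y"
  and star_mult: "x \<in> carrier A \<Longrightarrow> y \<in> carrier A \<Longrightarrow> star A (x \<otimes> y) = star A y \<otimes> star A x"
  and star_scale: "x \<in> carrier A \<Longrightarrow> star A (a \<odot> x) = cnj a \<odot> star A x"
  using cstar by (simp_all add: unital_cstar_algebra_def)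

lemma scale_closed [simp]: "x \<in> carrier A \<Longrightarrow> a \<odot> x \<in> carrier A"
  using smult_closed[of a x] by simp

lemma star_one: "star A \<one> = \<one>"
  using star_mult[of \<one> "star A \<one>"] by simp

lemma zero_scale: "x \<in> carrier A \<Longrightarrow> 0 \<odot> x = \<zero>"
  using smult_l_null[of x] by simp

lemma star_zero: "star A \<zero> = \<zero>"
  using star_scale[of \<zero> 0] by (simp add: zero_scale)

lemma word_prod_closed: "xs \<in> lists (carrier A) \<Longrightarrow> word_prod A xs \<in> carrier A"
  by (induction xs) (auto simp: word_prod_def)

lemma word_prod_append:
  "xs \<in> lists (carrier A) \<Longrightarrow> ys \<in> lists (carrier A) \<Longrightarrow>
    word_prod A (xs @ ys) = word_prod A xs \<otimes> word_prod A ys"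
proof (induction xs)
  case Nil
  then show ?case using word_prod_closed[of ys] by (simp add: word_prod_def)
next
  case (Cons x xs)
  then show ?case
    using word_prod_closed[of xs] word_prod_closed[of ys] by (simp add: word_prod_def Alg.m_assoc)
qed

definition self_adjoint :: "'a set" where
  "self_adjoint = {x \<in> carrier A. star A x = x}"

lemma star_word_prod:
  assumes "X \<subseteq> self_adjoint"
  shows "xs \<in> lists X \<Longrightarrow> star A (word_prod A xs) = word_prod A (rev xs)"
proof (induction xs)
  case Nil
  then show ?case by (simp add: word_prod_def star_one)
next
  case (Cons x xs)
  then have xs: "xs \<in> lists (carrier A)" "x \<in> carrier A" "star A x = x"
    using assms by (auto simp: self_adjoint_def)
  have "word_prod A (rev xs @ [x]) = word_prod A (rev xs) \<otimes> x"
    using xs by (subst word_prod_append) (auto simp: word_prod_def)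
  moreover have "word_prod A (x # xs) = x \<otimes> word_prod A xs" by (simp add: word_prod_def)
  ultimately show ?case
    using Cons xs word_prod_closed[OF xs(1)] by (simp add: star_mult)
qed

end

text \<open>
  The minimal length in the definition of words can be replaced by the length of an arbitrary
  representing list, which shows that there are finitely many short words and makes products easy
  to handle.
\<close>

lemma words_upto_eq_image: "words_upto A X N = word_prod A ` {xs \<in> lists X. length xs \<le> N}"
proof (intro equalityI subsetI)
  fix g assume "g \<in> words_upto A X N"
  then have "\<exists>m. \<exists>xs\<in>lists X. length xs = m \<and> g = word_prod A xs" and "word_length A X g \<le> N"
    by (auto simp: words_upto_def is_word_def)
  from LeastI_ex[OF this(1)] this(2) show "g \<in> word_prod A ` {xs \<in> lists X. length xs \<le> N}"
    unfolding word_length_def by fastforce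
next
  fix g assume "g \<in> word_prod A ` {xs \<in> lists X. length xs \<le> N}"
  then obtain xs where xs: "xs \<in> lists X" "length xs \<le> N" "g = word_prod A xs" by auto
  then have "word_length A X g \<le> length xs"
    unfolding word_length_def by (intro Least_le) auto
  with xs show "g \<in> words_upto A X N" by (auto simp: words_upto_def is_word_def)
qed

lemma finite_words_upto:
  assumes "finite X"
  shows "finite (words_upto A X N)"
  using finite_lists_length_le[OF assms, of N]
  unfolding words_upto_eq_image lists_eq_set by (simp add: conj_commute)

lemma words_upto_0: "words_upto A X 0 = {\<one>\<^bsub>A\<^esub>}"
  by (auto simp: words_upto_eq_image word_prod_def image_iff)

context unital_cstar
begin

lemma words_upto_closed: "X \<subseteq> carrier A \<Longrightarrow> words_upto A X N \<subseteq> carrier A"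
  unfolding words_upto_eq_image using word_prod_closed lists_mono by blast

text \<open>
  Only finitely many words occur in a linear combination, so their lengths are bounded. Writing
  the union as a single span makes it visibly a submodule.
\<close>

lemma alg_eq_span_words: "alg A X = span {g. is_word A X g}"
proof
  have "words_upto A X N \<subseteq> {g. is_word A X g}" for N by (auto simp: words_upto_def)
  then show "alg A X \<subseteq> span {g. is_word A X g}"
    using span_is_monotone unfolding alg_def alg_upto_def by blast
next
  show "span {g. is_word A X g} \<subseteq> alg A X"
  proof
    fix p assume "p \<in> span {g. is_word A X g}"
    then obtain a F where F: "finite F" "F \<subseteq> {g. is_word A X g}" "p = lincomb a F"
      by (auto simp: span_def)
    obtain N where "\<forall>n\<in>word_length A X ` F. n \<le> N"
      using F(1) finite_nat_set_iff_bounded_le by blast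
    with F(2) have "F \<subseteq> words_upto A X N" by (auto simp: words_upto_def)
    with F(1,3) have "p \<in> alg_upto A X N" by (auto simp: alg_upto_def span_def)
    then show "p \<in> alg A X" by (auto simp: alg_def)
  qed
qed

lemma submodule_alg:
  assumes "X \<subseteq> carrier A"
  shows "submodule class_ring (alg A X) A"
proof -
  have "{g. is_word A X g} \<subseteq> carrier A"
    using assms word_prod_closed lists_mono unfolding is_word_def by blast
  then show ?thesis unfolding alg_eq_span_words by (rule span_is_submodule)
qed

lemma word_in_alg:
  assumes "X \<subseteq> carrier A" "xs \<in> lists X"
  shows "word_prod A xs \<in> alg A X"
proof -
  have "{g. is_word A X g} \<subseteq> carrier A"
    using assms word_prod_closed lists_mono unfolding is_word_def by blast
  moreover have "is_word A X (word_prod A xs)" using assms(2) by (auto simp: is_word_def)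
  ultimately show ?thesis
    unfolding alg_eq_span_words using in_own_span by blast
qed

text \<open>
  For self-adjoint letters the adjoint of a word is the reversed word, so \<open>star A u \<otimes> v\<close> is again a
  word. This is what places the arguments of the Gram matrix in the domain of the functionals.
\<close>

lemma star_word_mult_word_in_alg:
  assumes X: "X \<subseteq> self_adjoint"
    and "u \<in> words_upto A X N" "v \<in> words_upto A X N"
  shows "star A u \<otimes> v \<in> alg A X"
proof -
  obtain xs ys where xs: "xs \<in> lists X" "u = word_prod A xs" and ys: "ys \<in> lists X" "v = word_prod A ys"
    using assms(2,3) by (auto simp: words_upto_eq_image)
  have "star A u \<otimes> v = word_prod A (rev xs @ ys)"
    using xs ys X by (subst word_prod_append) (auto simp: star_word_prod[OF X] self_adjoint_def)
  moreover have "rev xs @ ys \<in> lists X" using xs ys by auto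
  ultimately show ?thesis
    using word_in_alg[of X "rev xs @ ys"] X by (auto simp: self_adjoint_def)
qed

section \<open>Positivity as positive semidefiniteness of the Gram matrix\<close>

definition normalised_functionals :: "'a set \<Rightarrow> ('a \<Rightarrow> complex) set" where
  "normalised_functionals X = {s.
     (\<forall>x\<in>alg A X. \<forall>y\<in>alg A X. s (x \<oplus> y) = s x + s y) \<and>
     (\<forall>a. \<forall>x\<in>alg A X. s (a \<odot> x) = a * s x) \<and> s \<one> = 1}"

definition gram :: "nat \<Rightarrow> (nat \<Rightarrow> 'a) \<Rightarrow> ('a \<Rightarrow> complex) \<Rightarrow> complex mat" where
  "gram k h s = mat k k (\<lambda>(i, j). s (star A (h i) \<otimes> h j))"

lemma normalised_functionals_affine:
  assumes "s1 \<in> normalised_functionals X" "s2 \<in> normalised_functionals X"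
  shows "(\<lambda>x. complex_of_real (1 - t) * s1 x + complex_of_real t * s2 x) \<in> normalised_functionals X"
  using assms by (simp add: normalised_functionals_def algebra_simps)

text \<open>
  Sesquilinear expansion of \<open>s (star p p)\<close> is split into one lemma for each factor. The functional is
  linear on the submodule \<open>D\<close> only, so membership of the partial sums in \<open>D\<close> has to be carried
  through the induction together with the formula.
\<close>

lemma functional_mult_lincomb:
  assumes D: "submodule class_ring D A"
    and add: "\<And>x y. x \<in> D \<Longrightarrow> y \<in> D \<Longrightarrow> s (x \<oplus> y) = s x + s y"
    and scale: "\<And>a x. x \<in> D \<Longrightarrow> s (a \<odot> x) = a * s x"
    and y: "y \<in> carrier A"
    and F: "finite F" "F \<subseteq> carrier A" "\<And>v. v \<in> F \<Longrightarrow> y \<otimes> v \<in> D"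
  shows "y \<otimes> lincomb a F \<in> D \<and> s (y \<otimes> lincomb a F) = (\<Sum>v\<in>F. a v * s (y \<otimes> v))"
proof -
  interpret D: submodule class_ring D A by (rule D)
  from F show ?thesis
  proof (induction F rule: finite_induct)
    case empty
    then show ?case
      using scale[of \<zero> 0] y D.zero_closed by (simp add: lincomb_def zero_scale)
  next
    case (insert v F)
    then have IH: "y \<otimes> lincomb a F \<in> D" "s (y \<otimes> lincomb a F) = (\<Sum>v\<in>F. a v * s (y \<otimes> v))"
      and v: "v \<in> carrier A" "y \<otimes> v \<in> D" and F: "F \<subseteq> carrier A" by auto
    have l: "lincomb a F \<in> carrier A" using F insert by (intro lincomb_closed) auto
    have "lincomb a (insert v F) = a v \<odot> v \<oplus> lincomb a F"
      using lincomb_insert[of F a v] insert v F by simp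
    then have eq: "y \<otimes> lincomb a (insert v F) = a v \<odot> (y \<otimes> v) \<oplus> y \<otimes> lincomb a F"
      using y v l by (simp add: Alg.r_distr scale_mult)
    have m: "a v \<odot> (y \<otimes> v) \<in> D" using D.smult_closed[of "a v"] v by simp
    show ?case
      unfolding eq using add[OF m IH(1)] scale[OF v(2)] IH m insert.hyps by auto
  qed
qed

lemma functional_star_lincomb_mult:
  assumes D: "submodule class_ring D A"
    and add: "\<And>x y. x \<in> D \<Longrightarrow> y \<in> D \<Longrightarrow> s (x \<oplus> y) = s x + s y"
    and scale: "\<And>a x. x \<in> D \<Longrightarrow> s (a \<odot> x) = a * s x"
    and y: "y \<in> carrier A"
    and F: "finite F" "F \<subseteq> carrier A" "\<And>u. u \<in> F \<Longrightarrow> star A u \<otimes> y \<in> D"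
  shows "star A (lincomb a F) \<otimes> y \<in> D \<and>
    s (star A (lincomb a F) \<otimes> y) = (\<Sum>u\<in>F. cnj (a u) * s (star A u \<otimes> y))"
proof -
  interpret D: submodule class_ring D A by (rule D)
  from F show ?thesis
  proof (induction F rule: finite_induct)
    case empty
    then show ?case
      using scale[of \<zero> 0] y D.zero_closed by (simp add: lincomb_def zero_scale star_zero)
  next
    case (insert v F)
    then have IH: "star A (lincomb a F) \<otimes> y \<in> D"
        "s (star A (lincomb a F) \<otimes> y) = (\<Sum>u\<in>F. cnj (a u) * s (star A u \<otimes> y))"
      and v: "v \<in> carrier A" "star A v \<otimes> y \<in> D" and F: "F \<subseteq> carrier A" by auto
    have l: "lincomb a F \<in> carrier A" using F insert by (intro lincomb_closed) auto
    have "lincomb a (insert v F) = a v \<odot> v \<oplus> lincomb a F"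
      using lincomb_insert[of F a v] insert v F by simp
    then have eq: "star A (lincomb a (insert v F)) \<otimes> y =
        cnj (a v) \<odot> (star A v \<otimes> y) \<oplus> star A (lincomb a F) \<otimes> y"
      using y v l by (simp add: Alg.l_distr scale_mult star_add star_scale)
    have m: "cnj (a v) \<odot> (star A v \<otimes> y) \<in> D" using D.smult_closed[of "cnj (a v)"] v by simp
    show ?case
      unfolding eq using add[OF m IH(1)] scale[OF v(2)] IH m insert.hyps by auto
  qed
qed

lemma functional_square_lincomb:
  assumes X: "X \<subseteq> self_adjoint" and "finite X"
    and s: "s \<in> normalised_functionals X"
    and h: "bij_betw h {..<k} (words_upto A X N)"
  shows "s (star A (lincomb a (words_upto A X N)) \<otimes> lincomb a (words_upto A X N)) =
    quad_form k (gram k h s) (\<lambda>i. a (h i))"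
proof -
  let ?W = "words_upto A X N"
  have sub: "X \<subseteq> carrier A" using X by (auto simp: self_adjoint_def)
  note W = words_upto_closed[OF sub, of N] finite_words_upto[OF \<open>finite X\<close>, of A N]
  have add: "s (x \<oplus> y) = s x + s y" if "x \<in> alg A X" "y \<in> alg A X" for x y
    using s that by (simp add: normalised_functionals_def)
  have scale: "s (a \<odot> x) = a * s x" if "x \<in> alg A X" for a x
    using s that by (simp add: normalised_functionals_def)
  note D = submodule_alg[OF sub]
  have l: "lincomb a ?W \<in> carrier A" using W by (intro lincomb_closed) auto
  have right: "star A u \<otimes> lincomb a ?W \<in> alg A X"
      "s (star A u \<otimes> lincomb a ?W) = (\<Sum>v\<in>?W. a v * s (star A u \<otimes> v))" if "u \<in> ?W" for u
    using functional_mult_lincomb[OF D add scale _ W(2,1), of "star A u" a] that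
      star_word_mult_word_in_alg[OF X that] W(1) by auto
  have "s (star A (lincomb a ?W) \<otimes> lincomb a ?W) =
      (\<Sum>u\<in>?W. cnj (a u) * (\<Sum>v\<in>?W. a v * s (star A u \<otimes> v)))"
    using functional_star_lincomb_mult[OF D add scale l W(2,1), of a] right by simp
  also have "\<dots> = (\<Sum>i<k. cnj (a (h i)) * (\<Sum>j<k. a (h j) * s (star A (h i) \<otimes> h j)))"
    by (simp add: sum.reindex_bij_betw[OF h, symmetric])
  also have "\<dots> = quad_form k (gram k h s) (\<lambda>i. a (h i))"
    by (auto simp: quad_form_def gram_def sum_distrib_left mult_ac intro!: sum.cong)
  finally show ?thesis .
qed

text \<open>
  Distinct words may be linearly dependent in the algebra, but this does no harm: every
  coefficient vector gives some \<open>p\<close>, and every \<open>p\<close> in the span has some coefficient vector.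
\<close>

lemma functionals_iff_gram_psd:
  assumes X: "X \<subseteq> self_adjoint" and "finite X"
    and h: "bij_betw h {..<k} (words_upto A X N)"
  shows "s \<in> functionals A X N \<longleftrightarrow> s \<in> normalised_functionals X \<and> gram k h s \<in> psd_mats k"
proof -
  let ?W = "words_upto A X N"
  have sub: "X \<subseteq> carrier A" using X by (auto simp: self_adjoint_def)
  have span: "alg_upto A X N = {lincomb a ?W | a. True}"
    using finite_span[OF finite_words_upto[OF \<open>finite X\<close>] words_upto_closed[OF sub], of N]
    by (auto simp: alg_upto_def)
  have psd: "(\<forall>p\<in>alg_upto A X N. 0 \<le> s (star A p \<otimes> p)) \<longleftrightarrow> gram k h s \<in> psd_mats k"
    if s: "s \<in> normalised_functionals X"
  proof -
    have "(\<forall>p\<in>alg_upto A X N. 0 \<le> s (star A p \<otimes> p)) \<longleftrightarrow>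
        (\<forall>a. 0 \<le> quad_form k (gram k h s) (\<lambda>i. a (h i)))"
      using functional_square_lincomb[OF X \<open>finite X\<close> s h] unfolding span by auto
    also have "\<dots> \<longleftrightarrow> (\<forall>x. 0 \<le> quad_form k (gram k h s) x)"
    proof (intro iffI allI)
      fix x assume *: "\<forall>a. 0 \<le> quad_form k (gram k h s) (\<lambda>i. a (h i))"
      (* h is injective, so coefficients indexed by positions are coefficients indexed by words. *)
      have "quad_form k (gram k h s) (\<lambda>i. x (inv_into {..<k} h (h i))) = quad_form k (gram k h s) x"
        using h by (simp add: quad_form_def bij_betw_def)
      with *[rule_format, of "\<lambda>u. x (inv_into {..<k} h u)"]
      show "0 \<le> quad_form k (gram k h s) x" by simp
    qed auto
    also have "\<dots> \<longleftrightarrow> gram k h s \<in> psd_mats k"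
      by (simp add: psd_mats_iff gram_def)
    finally show ?thesis .
  qed
  have "s \<in> functionals A X N \<longleftrightarrow>
      s \<in> normalised_functionals X \<and> (\<forall>p\<in>alg_upto A X N. 0 \<le> s (star A p \<otimes> p))"
    by (auto simp: functionals_def normalised_functionals_def)
  with psd show ?thesis by blast
qed

text \<open>
  The empty word is the only one of length zero, so the Gram matrix is the \<open>1 \<times> 1\<close> matrix with entry
  \<open>s \<one> = 1\<close>, and its positivity imposes no condition.
\<close>

lemma functionals_0:
  assumes X: "X \<subseteq> self_adjoint" and "finite X"
  shows "functionals A X 0 = normalised_functionals X"
proof -
  have h: "bij_betw (\<lambda>_. \<one>) {..<1::nat} (words_upto A X 0)"
    by (auto simp: words_upto_0 bij_betw_def inj_on_def)
  have "gram 1 (\<lambda>_. \<one>) s \<in> psd_mats 1" if "s \<in> normalised_functionals X" for s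
  proof -
    have "gram 1 (\<lambda>_. \<one>) s = mat 1 1 (\<lambda>(i, j). (\<lambda>_. 1) i * cnj ((\<lambda>_. 1) j))"
      using that by (auto simp: gram_def star_one normalised_functionals_def)
    then show ?thesis using rank_one_psd[of 1 "\<lambda>_. 1"] by simp
  qed
  then show ?thesis using functionals_iff_gram_psd[OF X \<open>finite X\<close> h] by auto
qed

section \<open>The correlation sets\<close>

lemma affine_gram_image: "affine_mats k (gram k h ` normalised_functionals X)"
  unfolding affine_mats_def
proof (intro conjI ballI allI)
  fix P Q and t :: real
  assume "P \<in> gram k h ` normalised_functionals X" "Q \<in> gram k h ` normalised_functionals X"
  then obtain s1 s2 where s: "s1 \<in> normalised_functionals X" "s2 \<in> normalised_functionals X"
    "P = gram k h s1" "Q = gram k h s2" by auto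
  have "complex_of_real (1 - t) \<cdot>\<^sub>m P + complex_of_real t \<cdot>\<^sub>m Q =
      gram k h (\<lambda>x. complex_of_real (1 - t) * s1 x + complex_of_real t * s2 x)"
    unfolding s gram_def by (intro eq_matI) auto
  then show "complex_of_real (1 - t) \<cdot>\<^sub>m P + complex_of_real t \<cdot>\<^sub>m Q \<in> gram k h ` normalised_functionals X"
    using normalised_functionals_affine[OF s(1,2)] by auto
qed (auto simp: gram_def)

lemma correlations_projected_spectrahedron:
  fixes e f :: "'v::finite \<Rightarrow> 'c::finite \<Rightarrow> 'a"
  assumes ef: "commuting_projection_families A e f"
  shows "\<exists>k B \<pi>. spectrahedron k B \<and> linear_on_mats k \<pi> \<and> correlations A e f N = \<pi> ` B"
proof -
  define X where "X = generators e f"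
  have X: "X \<subseteq> self_adjoint"
    using ef
    by (auto simp: X_def self_adjoint_def generators_def commuting_projection_families_def is_projection_def)
  have "X = range (case_prod e) \<union> range (case_prod f)"
    by (auto simp: X_def generators_def image_iff)
  then have fin: "finite X" by simp
  define corr :: "('a \<Rightarrow> complex) \<Rightarrow> ('v, 'c) block_matrix" where
    "corr s = (\<lambda>(v, i, w, j). s (e v i \<otimes> f w j))" for s
  have K: "correlations A e f N = corr ` functionals A X N"
    by (auto simp: correlations_def corr_def X_def)
  show ?thesis
  proof (cases "N = 0")
    case True
    (* Without positivity conditions the correlations form the image of an affine set. *)
    show ?thesis
    proof (rule affine_set_is_projected_spectrahedron)
      fix a b and t :: real
      assume "a \<in> correlations A e f N" "b \<in> correlations A e f N"
      then obtain s1 s2 where s: "s1 \<in> normalised_functionals X" "s2 \<in> normalised_functionals X"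
        "a = corr s1" "b = corr s2" using True functionals_0[OF X fin] K by auto
      have "(\<lambda>x. complex_of_real (1 - t) * a x + complex_of_real t * b x) =
          corr (\<lambda>x. complex_of_real (1 - t) * s1 x + complex_of_real t * s2 x)"
        by (auto simp: s corr_def fun_eq_iff)
      then show "(\<lambda>x. complex_of_real (1 - t) * a x + complex_of_real t * b x) \<in> correlations A e f N"
        using True functionals_0[OF X fin] K normalised_functionals_affine[OF s(1,2)] by auto
    qed
  next
    case False
    let ?W = "words_upto A X N"
    obtain h :: "nat \<Rightarrow> 'a" where h: "bij_betw h {..<card ?W} ?W"
      using ex_bij_betw_nat_finite[OF finite_words_upto[OF fin]] by (metis atLeast0LessThan)
    define k where "k = card ?W"
    define pos where "pos = inv_into {..<k} h"
    (* Since N is positive, every generator is one of the enumerated words. *)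
    have gen: "pos x < k" "h (pos x) = x" if "x \<in> X" for x
    proof -
      have "[x] \<in> {xs \<in> lists X. length xs \<le> N}" using that False by auto
      moreover have "word_prod A [x] = x" using X that by (auto simp: self_adjoint_def word_prod_def)
      ultimately have "x \<in> ?W" unfolding words_upto_eq_image by (metis imageI)
      then have "x \<in> h ` {..<k}" using h by (simp add: bij_betw_def k_def)
      then show "pos x < k" "h (pos x) = x"
        unfolding pos_def using inv_into_into[of x h "{..<k}"] by (auto simp: f_inv_into_f)
    qed
    have ef_X: "e v i \<in> X" "f v i \<in> X" for v i by (auto simp: X_def generators_def)
    define \<pi> :: "complex mat \<Rightarrow> ('v, 'c) block_matrix" where
      "\<pi> M = (\<lambda>(v, i, w, j). M $$ (pos (e v i), pos (f w j)))" for M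
    have "spectrahedron k (psd_mats k \<inter> gram k h ` normalised_functionals X)"
      unfolding spectrahedron_def using affine_gram_image by blast
    moreover have "linear_on_mats k \<pi>"
      unfolding linear_on_mats_def \<pi>_def using gen(1) ef_X by auto
    moreover have "correlations A e f N = \<pi> ` (psd_mats k \<inter> gram k h ` normalised_functionals X)"
    proof -
      (* The row index contributes star (e v i), which is e v i. *)
      have "\<pi> (gram k h s) = corr s" for s
        using gen ef_X X by (auto simp: \<pi>_def gram_def corr_def self_adjoint_def subset_iff)
      moreover have "psd_mats k \<inter> gram k h ` normalised_functionals X = gram k h ` functionals A X N"
        using functionals_iff_gram_psd[OF X fin] h unfolding k_def by blast
      ultimately show ?thesis unfolding K by (simp add: image_image)
    qed
    ultimately show ?thesis by blast
  qed
qed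

end

lemma linear_functional_graph_functional: "linear_functional (graph_functional E)"
  unfolding linear_functional_def graph_functional_def case_prod_unfold
  by (simp only: sum.distrib sum_distrib_left distrib_left) (simp add: ac_simps)

theorem proposition4p1:
  fixes E :: "('v::finite \<times> 'v) set"
    and A :: "'a star_normed_algebra"
    and e f :: "'v \<Rightarrow> 'c::finite \<Rightarrow> 'a"
    and N :: nat
  assumes "sym E" and "irrefl E"
    and "universal_cstar_algebra A e f"
  shows "minimisation_is_SDP (graph_functional E) (correlations A e f N)"
proof -
  interpret unital_cstar A
    using assms(3) by unfold_locales (simp add: universal_cstar_algebra_def)
  show ?thesis
    unfolding minimisation_is_SDP_def
    using linear_functional_graph_functional[of E] correlations_projected_spectrahedron[of e f N]
      assms(3)
    by (simp add: universal_cstar_algebra_def)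
qed

end
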